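(* Let $(T_t)_{t\ge 0}$ be an individually eventually positive $C_0$-semigroup on a complex Banach lattice $E$. Let $g\in E_+$, let $Y$ be a real Banach space, and let $J\colon Y\to E_{\mathbb R}$ be a bounded (real-)linear operator such that $JY\subseteq E_g$. Then there exist $t_0\ge 0$ and $C\ge 0$ such that for all $t\ge t_0$ and all $y\in Y$, $$|T_tJy|\le C\,\|y\|_Y\,T_tg.$$ In particular, $T_tg\ge 0$ for all $t\ge t_0$.
   Context: For a complex Banach lattice $E$, $E_{\mathbb R}$ denotes its real part (a real Banach lattice whose complexification is $E$), $E_+$ its positive cone, and $|\cdot|$ the modulus on $E$; for $f\in E$, $f\ge 0$ means $f\in E_+$. A $C_0$-semigroup $(T_t)_{t\ge 0}$ on $E$ is called individually eventually positive if for every $f\in E_+$ there exists $t_f\ge 0$ (possibly depending on $f$) such that $T_tf\ge 0$ for all $t\ge t_f$. For $g\in E_+$, the principal ideal generated by $g$ is $E_g:=\{f\in E: |f|\le c\,g\text{ for some }c\ge 0\}$. *)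

theory Defs
  imports "HOL-Analysis.Analysis" "HOL-Library.Lattice_Algebras"
begin

section \<open>Real Banach lattices\<close>

class banach_lattice = banach + ordered_real_vector + lattice_ab_group_add_abs +
  assumes norm_lattice_mono: "\<bar>x\<bar> \<le> \<bar>y\<bar> \<Longrightarrow> norm x \<le> norm y"

instance real :: banach_lattice
  by standard simp

lemma norm_abs_lattice [simp]: "norm \<bar>x\<bar> = norm (x :: 'a::banach_lattice)"
  by (rule order.antisym; rule norm_lattice_mono; simp)

lemma norm_mono_nonneg: "0 \<le> x \<Longrightarrow> x \<le> y \<Longrightarrow> norm x \<le> norm (y :: 'a::banach_lattice)"
  by (rule norm_lattice_mono) (simp add: abs_of_nonneg)

lemma abs_scaleR_lattice: "\<bar>r *\<^sub>R x\<bar> = \<bar>r\<bar> *\<^sub>R \<bar>x :: 'a::banach_lattice\<bar>"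
proof -
  have *: "\<bar>r *\<^sub>R x\<bar> \<le> r *\<^sub>R \<bar>x\<bar>" if "0 \<le> r" for r and x :: 'a
  proof (rule abs_leI)
    show "r *\<^sub>R x \<le> r *\<^sub>R \<bar>x\<bar>"
      by (rule scaleR_left_mono) (simp_all add: that abs_ge_self)
    have "r *\<^sub>R (- x) \<le> r *\<^sub>R \<bar>x\<bar>"
      by (rule scaleR_left_mono) (simp_all add: that abs_ge_minus_self)
    then show "- (r *\<^sub>R x) \<le> r *\<^sub>R \<bar>x\<bar>" by simp
  qed
  have **: "\<bar>r *\<^sub>R x\<bar> = r *\<^sub>R \<bar>x\<bar>" if "0 \<le> r" for r and x :: 'a
  proof (cases "r = 0")
    case False
    with that have r: "r > 0" by simp
    have "\<bar>inverse r *\<^sub>R (r *\<^sub>R x)\<bar> \<le> inverse r *\<^sub>R \<bar>r *\<^sub>R x\<bar>"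
      using r by (intro *) simp
    then have "\<bar>x\<bar> \<le> inverse r *\<^sub>R \<bar>r *\<^sub>R x\<bar>" using r by simp
    then have "r *\<^sub>R \<bar>x\<bar> \<le> r *\<^sub>R (inverse r *\<^sub>R \<bar>r *\<^sub>R x\<bar>)"
      by (rule scaleR_left_mono) (use r in simp)
    then have "r *\<^sub>R \<bar>x\<bar> \<le> \<bar>r *\<^sub>R x\<bar>" using r by simp
    with *[OF that, of x] show ?thesis by (rule order.antisym)
  qed simp
  show ?thesis
  proof (cases "0 \<le> r")
    case True
    then show ?thesis by (simp add: **)
  next
    case False
    then have "\<bar>(- r) *\<^sub>R x\<bar> = (- r) *\<^sub>R \<bar>x\<bar>" by (intro **) simp
    then show ?thesis using False by simp
  qed
qed

lemma abs_dist_lattice: "norm (\<bar>x\<bar> - \<bar>y\<bar>) \<le> norm (x - y :: 'a::banach_lattice)"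
  by (rule norm_lattice_mono) (rule abs_triangle_ineq3)

lemma closed_nonneg_lattice: "closed {x :: 'a::banach_lattice. 0 \<le> x}"
proof -
  have "continuous_on UNIV (\<lambda>x :: 'a. \<bar>x\<bar>)"
    unfolding continuous_on_iff dist_norm
    using abs_dist_lattice le_less_trans by blast
  then have "closed {x :: 'a. \<bar>x\<bar> = x}"
    by (intro closed_Collect_eq continuous_intros) auto
  moreover have "{x :: 'a. \<bar>x\<bar> = x} = {x. 0 \<le> x}"
    by (auto simp: abs_of_nonneg) (metis abs_ge_zero)
  ultimately show ?thesis by simp
qed

lemma lattice_LIMSEQ_le:
  fixes X Y :: "nat \<Rightarrow> 'a::banach_lattice"
  assumes "X \<longlonglongrightarrow> a" "Y \<longlonglongrightarrow> b" "\<And>n. X n \<le> Y n"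
  shows "a \<le> b"
proof -
  have "(\<lambda>n. Y n - X n) \<longlonglongrightarrow> b - a"
    by (intro tendsto_diff assms)
  then have "b - a \<in> {x. 0 \<le> x}"
    by (rule closed_sequentially[OF closed_nonneg_lattice, rotated]) (simp add: assms)
  then show ?thesis by simp
qed


section \<open>The complexification of a real Banach lattice\<close>

text \<open>Complex Banach lattices are the complexifications of real ones: for a real Banach lattice
  \<^typ>\<open>'a\<close>, the type \<open>'a complexification\<close> is \<open>E = E\<^sub>\<real> \<oplus> i E\<^sub>\<real>\<close> with real part \<open>E\<^sub>\<real>\<close> = \<^typ>\<open>'a\<close>.\<close>

datatype 'a complexification = Cpx (re_part: 'a) (im_part: 'a)

lemma cpx_eqI: "re_part z = re_part w \<Longrightarrow> im_part z = im_part w \<Longrightarrow> z = w"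
  by (rule complexification.expand) simp

lemma cpx_eq_iff: "z = w \<longleftrightarrow> re_part z = re_part w \<and> im_part z = im_part w"
  by (auto intro: cpx_eqI)

instantiation complexification :: (real_vector) real_vector
begin

definition "0 = Cpx 0 0"
definition "z + w = Cpx (re_part z + re_part w) (im_part z + im_part w)"
definition "z - w = Cpx (re_part z - re_part w) (im_part z - im_part w)"
definition "- z = Cpx (- re_part z) (- im_part z)"
definition "r *\<^sub>R z = Cpx (r *\<^sub>R re_part z) (r *\<^sub>R im_part z)"

instance
  by standard
    (auto simp: zero_complexification_def plus_complexification_def minus_complexification_def
      uminus_complexification_def scaleR_complexification_def scaleR_add_right scaleR_add_left)

end

lemma cpx_parts [simp]:
  "re_part 0 = 0" "im_part 0 = 0"
  "re_part (z + w) = re_part z + re_part w" "im_part (z + w) = im_part z + im_part w"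
  "re_part (z - w) = re_part z - re_part w" "im_part (z - w) = im_part z - im_part w"
  "re_part (- z) = - re_part z" "im_part (- z) = - im_part z"
  "re_part (r *\<^sub>R z) = r *\<^sub>R re_part z" "im_part (r *\<^sub>R z) = r *\<^sub>R im_part z"
  by (simp_all add: zero_complexification_def plus_complexification_def minus_complexification_def
      uminus_complexification_def scaleR_complexification_def)

definition scaleC :: "complex \<Rightarrow> 'a::real_vector complexification \<Rightarrow> 'a complexification"
    (infixr \<open>*\<^sub>C\<close> 75) where
  "c *\<^sub>C z = Cpx (Re c *\<^sub>R re_part z - Im c *\<^sub>R im_part z) (Re c *\<^sub>R im_part z + Im c *\<^sub>R re_part z)"

lemma scaleC_parts [simp]:
  "re_part (c *\<^sub>C z) = Re c *\<^sub>R re_part z - Im c *\<^sub>R im_part z"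
  "im_part (c *\<^sub>C z) = Re c *\<^sub>R im_part z + Im c *\<^sub>R re_part z"
  by (simp_all add: scaleC_def)

lemma scaleC_vector_space:
  "c *\<^sub>C (z + w) = c *\<^sub>C z + c *\<^sub>C w"
  "(c + d) *\<^sub>C z = c *\<^sub>C z + d *\<^sub>C z"
  "c *\<^sub>C d *\<^sub>C z = (c * d) *\<^sub>C z"
  "1 *\<^sub>C z = z"
  "complex_of_real r *\<^sub>C z = r *\<^sub>R z"
  by (simp_all add: cpx_eq_iff algebra_simps)

definition of_re :: "'a::real_vector \<Rightarrow> 'a complexification" where
  "of_re x = Cpx x 0"

lemma of_re_parts [simp]: "re_part (of_re x) = x" "im_part (of_re x) = 0"
  by (simp_all add: of_re_def)

text \<open>The order on \<open>E\<close> is the one with positive cone \<open>E\<^sub>+ = (E\<^sub>\<real>)\<^sub>+\<close>; thus \<open>f \<le> h\<close> in \<open>E\<close> means that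
  \<open>h - f\<close> is real and positive.\<close>

instantiation complexification :: (ordered_real_vector) ordered_real_vector
begin

definition "z \<le> w \<longleftrightarrow> re_part z \<le> re_part w \<and> im_part z = im_part w"
definition "(z :: 'a complexification) < w \<longleftrightarrow> z \<le> w \<and> \<not> w \<le> z"

instance
  by standard
    (auto simp: less_eq_complexification_def less_complexification_def cpx_eq_iff
      intro: scaleR_left_mono scaleR_right_mono)

end

lemma cpx_nonneg_iff: "0 \<le> z \<longleftrightarrow> (\<exists>x\<ge>0. z = of_re x)"
  by (auto simp: less_eq_complexification_def cpx_eq_iff)

lemma of_re_le_iff [simp]: "of_re x \<le> of_re y \<longleftrightarrow> x \<le> y"
  by (simp add: less_eq_complexification_def)


subsection \<open>Modulus and norm\<close>

text \<open>The modulus of \<open>x + iy\<close> is \<open>sup\<^sub>\<theta> Re (e\<^sup>i\<^sup>\<theta> (x - iy)) = sup\<^sub>\<theta> (cos \<theta> x + sin \<theta> y)\<close>; the supremum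
  exists by norm completeness (see \<open>modulus_exists\<close> below).\<close>

definition modulus :: "'a::banach_lattice complexification \<Rightarrow> 'a" where
  "modulus z = (THE m. (\<forall>\<theta>. cos \<theta> *\<^sub>R re_part z + sin \<theta> *\<^sub>R im_part z \<le> m) \<and>
     (\<forall>b. (\<forall>\<theta>. cos \<theta> *\<^sub>R re_part z + sin \<theta> *\<^sub>R im_part z \<le> b) \<longrightarrow> m \<le> b))"

lemma scaleR_le_abs_lattice: "r *\<^sub>R x \<le> \<bar>r\<bar> *\<^sub>R \<bar>x :: 'a::banach_lattice\<bar>"
  by (metis abs_ge_self abs_scaleR_lattice)

lemma modulus_exists:
  fixes x y :: "'a::banach_lattice"
  shows "\<exists>m. (\<forall>\<theta>. cos \<theta> *\<^sub>R x + sin \<theta> *\<^sub>R y \<le> m) \<and>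
    (\<forall>b. (\<forall>\<theta>. cos \<theta> *\<^sub>R x + sin \<theta> *\<^sub>R y \<le> b) \<longrightarrow> m \<le> b)"
proof -
  define f where "f = (\<lambda>c. Re c *\<^sub>R x + Im c *\<^sub>R y)"
  define u where "u = \<bar>x\<bar> + \<bar>y\<bar>"
  have u0: "0 \<le> u" by (simp add: u_def)
  have f_lip: "f c \<le> f d + cmod (c - d) *\<^sub>R u" for c d
  proof -
    have "f c - f d = (Re (c - d)) *\<^sub>R x + (Im (c - d)) *\<^sub>R y"
      by (simp add: f_def algebra_simps)
    also have "\<dots> \<le> \<bar>Re (c - d)\<bar> *\<^sub>R \<bar>x\<bar> + \<bar>Im (c - d)\<bar> *\<^sub>R \<bar>y\<bar>"
      by (intro add_mono scaleR_le_abs_lattice)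
    also have "\<dots> \<le> cmod (c - d) *\<^sub>R \<bar>x\<bar> + cmod (c - d) *\<^sub>R \<bar>y\<bar>"
      by (intro add_mono scaleR_right_mono abs_Re_le_cmod abs_Im_le_cmod) simp_all
    finally show ?thesis by (simp add: u_def algebra_simps)
  qed
  have "\<forall>n. \<exists>G. finite G \<and> G \<subseteq> sphere (0::complex) 1 \<and>
      sphere 0 1 \<subseteq> (\<Union>c\<in>G. ball c (inverse (real (Suc n))))"
  proof
    fix n
    have "0 < inverse (real (Suc n))" by simp
    then show "\<exists>G. finite G \<and> G \<subseteq> sphere (0::complex) 1 \<and>
      sphere 0 1 \<subseteq> (\<Union>c\<in>G. ball c (inverse (real (Suc n))))"
      using seq_compact_imp_totally_bounded[of "sphere (0::complex) 1"]
        compact_imp_seq_compact[OF compact_sphere] by blast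
  qed
  then obtain G where G: "\<And>n. finite (G n)" "\<And>n. G n \<subseteq> sphere (0::complex) 1"
      "\<And>n. sphere 0 1 \<subseteq> (\<Union>c\<in>G n. ball c (inverse (real (Suc n))))"
    by metis
  have Gne: "G n \<noteq> {}" for n
    using G(3)[of n] by (force simp: subset_iff dest: spec[of _ "1::complex"])
  have Gcmod: "cmod c = 1" if "c \<in> G n" for c n
    using G(2)[of n] that by (auto simp: subset_iff)
  define s where "s = (\<lambda>n. Sup_fin (f ` G n))"
  have s_upper: "f c \<le> s n" if "c \<in> G n" for c n
    unfolding s_def using G(1) that by (intro Sup_fin.coboundedI) auto
  have s_least: "s n \<le> b" if "\<And>c. c \<in> G n \<Longrightarrow> f c \<le> b" for n b
    unfolding s_def using G(1) Gne that by (intro Sup_fin.boundedI) auto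
  have near: "f c \<le> s n + inverse (real (Suc n)) *\<^sub>R u" if "cmod c = 1" for c n
  proof -
    have "c \<in> sphere 0 1" using that by simp
    then obtain d where d: "d \<in> G n" "dist d c < inverse (real (Suc n))"
      using G(3)[of n] by auto
    have "f c \<le> f d + cmod (c - d) *\<^sub>R u" by (rule f_lip)
    also have "\<dots> \<le> s n + inverse (real (Suc n)) *\<^sub>R u"
      using d u0 by (intro add_mono s_upper scaleR_right_mono)
        (auto simp: dist_norm norm_minus_commute)
    finally show ?thesis .
  qed
  have s_near: "s m \<le> s n + inverse (real (Suc n)) *\<^sub>R u" for m n
    by (rule s_least, rule near, rule Gcmod)
  have s_dist: "norm (s m - s n) \<le> (inverse (real (Suc m)) + inverse (real (Suc n))) * norm u" for m n
  proof -
    let ?e = "\<lambda>n. inverse (real (Suc n))"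
    have e: "0 \<le> ?e k *\<^sub>R u" for k
      using u0 by (intro scaleR_nonneg_nonneg) simp_all
    have "\<bar>s m - s n\<bar> \<le> ?e m *\<^sub>R u + ?e n *\<^sub>R u"
    proof (rule abs_leI)
      have "s m - s n \<le> ?e n *\<^sub>R u"
        using s_near[of m n] by (simp add: diff_le_eq add.commute)
      also have "\<dots> \<le> ?e m *\<^sub>R u + ?e n *\<^sub>R u" using e[of m] by (rule add_increasing) simp
      finally show "s m - s n \<le> ?e m *\<^sub>R u + ?e n *\<^sub>R u" .
      have "- (s m - s n) \<le> ?e m *\<^sub>R u"
        using s_near[of n m] by (simp add: diff_le_eq add.commute)
      also have "\<dots> \<le> ?e m *\<^sub>R u + ?e n *\<^sub>R u" using e[of n] by (rule add_increasing2) simp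
      finally show "- (s m - s n) \<le> ?e m *\<^sub>R u + ?e n *\<^sub>R u" .
    qed
    then have "norm \<bar>s m - s n\<bar> \<le> norm (?e m *\<^sub>R u + ?e n *\<^sub>R u)"
      by (intro norm_mono_nonneg) simp_all
    also have "\<dots> \<le> ?e m * norm u + ?e n * norm u"
      by (rule order.trans[OF norm_triangle_ineq]) simp
    finally show ?thesis by (simp add: algebra_simps)
  qed
  have inv0: "(\<lambda>n. inverse (real (Suc n))) \<longlonglongrightarrow> 0"
    by (rule LIMSEQ_inverse_real_of_nat)
  have "Cauchy s"
  proof (rule CauchyI)
    fix e :: real assume "0 < e"
    have "(\<lambda>n. inverse (real (Suc n)) * (2 * norm u)) \<longlonglongrightarrow> 0 * (2 * norm u)"
      by (intro tendsto_mult inv0 tendsto_const)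
    then have "\<forall>\<^sub>F n in sequentially. inverse (real (Suc n)) * (2 * norm u) < e"
      using \<open>0 < e\<close> by (auto simp: order_tendsto_iff)
    then obtain N where N: "inverse (real (Suc N)) * (2 * norm u) < e"
      by (auto simp: eventually_sequentially)
    have "norm (s m - s n) < e" if "N \<le> m" "N \<le> n" for m n
    proof -
      have "inverse (real (Suc m)) \<le> inverse (real (Suc N))"
           "inverse (real (Suc n)) \<le> inverse (real (Suc N))"
        using that by (auto intro!: le_imp_inverse_le)
      then have "(inverse (real (Suc m)) + inverse (real (Suc n))) * norm u
          \<le> (2 * inverse (real (Suc N))) * norm u"
        by (intro mult_right_mono) (linarith, simp)
      with s_dist[of m n] N show ?thesis by simp
    qed
    then show "\<exists>N. \<forall>m\<ge>N. \<forall>n\<ge>N. norm (s m - s n) < e" by blast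
  qed
  then obtain l where l: "s \<longlonglongrightarrow> l"
    using convergent_eq_Cauchy by blast
  have l': "(\<lambda>n. s n + inverse (real (Suc n)) *\<^sub>R u) \<longlonglongrightarrow> l"
    using tendsto_add[OF l tendsto_scaleR[OF inv0 tendsto_const[of u]]] by simp
  have cs: "cos \<theta> *\<^sub>R x + sin \<theta> *\<^sub>R y = f (cis \<theta>)" for \<theta>
    by (simp add: f_def)
  show ?thesis
  proof (intro exI[of _ l] conjI allI impI)
    fix \<theta>
    show "cos \<theta> *\<^sub>R x + sin \<theta> *\<^sub>R y \<le> l"
      unfolding cs by (rule lattice_LIMSEQ_le[OF tendsto_const l']) (simp only: near norm_cis)
  next
    fix b assume b: "\<forall>\<theta>. cos \<theta> *\<^sub>R x + sin \<theta> *\<^sub>R y \<le> b"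
    have "s n \<le> b" for n
    proof (rule s_least)
      fix c assume "c \<in> G n"
      then have "cmod c = 1" by (rule Gcmod)
      then have "c = cis (Arg c)" by (metis rcis_cmod_Arg rcis_def mult_1 of_real_1)
      then show "f c \<le> b" using b cs by metis
    qed
    then show "l \<le> b" by (rule lattice_LIMSEQ_le[OF l tendsto_const])
  qed
qed

lemma modulus_lub:
  "cos \<theta> *\<^sub>R re_part z + sin \<theta> *\<^sub>R im_part z \<le> modulus z"
  "(\<And>\<theta>. cos \<theta> *\<^sub>R re_part z + sin \<theta> *\<^sub>R im_part z \<le> b) \<Longrightarrow> modulus z \<le> b"
proof -
  let ?P = "\<lambda>m. (\<forall>\<theta>. cos \<theta> *\<^sub>R re_part z + sin \<theta> *\<^sub>R im_part z \<le> m) \<and>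
     (\<forall>b. (\<forall>\<theta>. cos \<theta> *\<^sub>R re_part z + sin \<theta> *\<^sub>R im_part z \<le> b) \<longrightarrow> m \<le> b)"
  have "\<exists>!m. ?P m"
    by (rule ex_ex1I[OF modulus_exists]) (blast intro: order.antisym)
  then have "?P (modulus z)" unfolding modulus_def by (rule theI')
  then show "cos \<theta> *\<^sub>R re_part z + sin \<theta> *\<^sub>R im_part z \<le> modulus z"
    "(\<And>\<theta>. cos \<theta> *\<^sub>R re_part z + sin \<theta> *\<^sub>R im_part z \<le> b) \<Longrightarrow> modulus z \<le> b" by blast+
qed

lemma modulus_ge_parts: "\<bar>re_part z\<bar> \<le> modulus z" "\<bar>im_part z\<bar> \<le> modulus z"
  using modulus_lub(1)[of 0 z] modulus_lub(1)[of pi z]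
    modulus_lub(1)[of "pi / 2" z] modulus_lub(1)[of "- (pi / 2)" z]
  by (auto intro: abs_leI)

lemma modulus_nonneg [simp]: "0 \<le> modulus z"
  using modulus_ge_parts(1) abs_ge_zero order.trans by blast

lemma modulus_le_parts: "modulus z \<le> \<bar>re_part z\<bar> + \<bar>im_part z\<bar>"
proof (rule modulus_lub(2))
  fix \<theta> :: real
  have "cos \<theta> *\<^sub>R re_part z + sin \<theta> *\<^sub>R im_part z
      \<le> \<bar>cos \<theta>\<bar> *\<^sub>R \<bar>re_part z\<bar> + \<bar>sin \<theta>\<bar> *\<^sub>R \<bar>im_part z\<bar>"
    by (intro add_mono scaleR_le_abs_lattice)
  also have "\<dots> \<le> 1 *\<^sub>R \<bar>re_part z\<bar> + 1 *\<^sub>R \<bar>im_part z\<bar>"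
    by (intro add_mono scaleR_right_mono) simp_all
  finally show "cos \<theta> *\<^sub>R re_part z + sin \<theta> *\<^sub>R im_part z \<le> \<bar>re_part z\<bar> + \<bar>im_part z\<bar>" by simp
qed

lemma modulus_of_re [simp]: "modulus (of_re x) = \<bar>x\<bar>"
  using modulus_ge_parts(1)[of "of_re x"] modulus_le_parts[of "of_re x"]
  by (intro order.antisym) simp_all

lemma modulus_eq_0_iff [simp]: "modulus z = 0 \<longleftrightarrow> z = 0"
proof
  assume "modulus z = 0"
  then show "z = 0" using modulus_ge_parts[of z] by (simp add: cpx_eq_iff)
next
  assume "z = 0"
  then show "modulus z = 0" using modulus_le_parts[of z] by (simp add: order.antisym)
qed

lemma modulus_triangle: "modulus (z + w) \<le> modulus z + modulus w"
proof (rule modulus_lub(2))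
  fix \<theta>
  show "cos \<theta> *\<^sub>R re_part (z + w) + sin \<theta> *\<^sub>R im_part (z + w) \<le> modulus z + modulus w"
    using add_mono[OF modulus_lub(1)[of \<theta> z] modulus_lub(1)[of \<theta> w]] by (simp add: algebra_simps)
qed

lemma modulus_scaleC: "modulus (c *\<^sub>C z) = cmod c *\<^sub>R modulus z"
proof -
  have le: "modulus (c *\<^sub>C z) \<le> cmod c *\<^sub>R modulus z" for c and z :: "'a complexification"
  proof (rule modulus_lub(2))
    fix \<theta> :: real
    obtain r \<phi> where c: "c = rcis r \<phi>" "r = cmod c" by (metis rcis_cmod_Arg)
    have "cos \<theta> *\<^sub>R re_part (c *\<^sub>C z) + sin \<theta> *\<^sub>R im_part (c *\<^sub>C z)
      = r *\<^sub>R (cos (\<theta> - \<phi>) *\<^sub>R re_part z + sin (\<theta> - \<phi>) *\<^sub>R im_part z)"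
      by (simp add: c(1) cos_diff sin_diff algebra_simps)
    also have "\<dots> \<le> r *\<^sub>R modulus z"
      by (rule scaleR_left_mono[OF modulus_lub(1)]) (simp add: c(2))
    finally show "cos \<theta> *\<^sub>R re_part (c *\<^sub>C z) + sin \<theta> *\<^sub>R im_part (c *\<^sub>C z) \<le> cmod c *\<^sub>R modulus z"
      by (simp add: c(2))
  qed
  show ?thesis
  proof (cases "c = 0")
    case True
    then show ?thesis using le[of 0 z] modulus_nonneg[of "0 *\<^sub>C z"]
      by (metis order.antisym norm_zero scaleR_zero_left)
  next
    case False
    have "modulus z = modulus (inverse c *\<^sub>C c *\<^sub>C z)"
      using False by (simp only: scaleC_vector_space) (simp add: scaleC_vector_space(4))
    also have "\<dots> \<le> cmod (inverse c) *\<^sub>R modulus (c *\<^sub>C z)" by (rule le)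
    finally have "cmod c *\<^sub>R modulus z \<le> cmod c *\<^sub>R (cmod (inverse c) *\<^sub>R modulus (c *\<^sub>C z))"
      by (rule scaleR_left_mono) simp
    then have "cmod c *\<^sub>R modulus z \<le> modulus (c *\<^sub>C z)"
      using False by (simp add: norm_inverse)
    with le[of c z] show ?thesis by (rule order.antisym)
  qed
qed

text \<open>\<open>\<bar>z\<bar>\<close> is the modulus regarded as an element of \<open>E\<^sub>+ \<subseteq> E\<close>.\<close>

instantiation complexification :: (banach_lattice) abs
begin
definition "\<bar>z\<bar> = of_re (modulus z)"
instance ..
end

instantiation complexification :: (banach_lattice) real_normed_vector
begin

definition norm_complexification_def: "norm z = norm (modulus z)"
definition "sgn (z :: 'a complexification) = z /\<^sub>R norm z"
definition "dist z w = norm (z - w :: 'a complexification)"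
definition uniformity_complexification_def:
  "(uniformity :: ('a complexification \<times> 'a complexification) filter)
    = (INF e\<in>{0 <..}. principal {(x, y). dist x y < e})"
definition open_complexification_def:
  "open (U :: 'a complexification set)
    \<longleftrightarrow> (\<forall>x\<in>U. eventually (\<lambda>(x', y). x' = x \<longrightarrow> y \<in> U) uniformity)"

instance
proof
  fix r :: real and z w :: "'a complexification"
  show "norm z = 0 \<longleftrightarrow> z = 0" by (simp add: norm_complexification_def)
  have "norm (z + w) \<le> norm (modulus z + modulus w)"
    unfolding norm_complexification_def by (intro norm_mono_nonneg modulus_triangle) simp
  also have "\<dots> \<le> norm z + norm w"
    unfolding norm_complexification_def by (rule norm_triangle_ineq)
  finally show "norm (z + w) \<le> norm z + norm w" .
  show "norm (r *\<^sub>R z) = \<bar>r\<bar> * norm z"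
    using modulus_scaleC[of "complex_of_real r" z]
    by (simp add: norm_complexification_def scaleC_vector_space(5))
qed (fact sgn_complexification_def dist_complexification_def uniformity_complexification_def
    open_complexification_def)+

end

lemma norm_of_re [simp]: "norm (of_re x) = norm (x :: 'a::banach_lattice)"
  by (simp add: norm_complexification_def)

lemma norm_scaleC: "norm (c *\<^sub>C z) = cmod c * norm (z :: 'a::banach_lattice complexification)"
  by (simp add: norm_complexification_def modulus_scaleC)

lemma norm_parts_le:
  fixes z :: "'a::banach_lattice complexification"
  shows "norm (re_part z) \<le> norm z" "norm (im_part z) \<le> norm z"
    and "norm z \<le> norm (re_part z) + norm (im_part z)"
proof -
  show "norm (re_part z) \<le> norm z" "norm (im_part z) \<le> norm z"
    unfolding norm_complexification_def
    by (rule norm_lattice_mono; simp add: modulus_ge_parts abs_of_nonneg)+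
  have "norm z \<le> norm (\<bar>re_part z\<bar> + \<bar>im_part z\<bar>)"
    unfolding norm_complexification_def by (intro norm_mono_nonneg modulus_le_parts) simp
  also have "\<dots> \<le> norm (re_part z) + norm (im_part z)"
    by (rule order.trans[OF norm_triangle_ineq]) simp
  finally show "norm z \<le> norm (re_part z) + norm (im_part z)" .
qed

instance complexification :: (banach_lattice) banach
proof
  fix X :: "nat \<Rightarrow> 'a complexification"
  assume X: "Cauchy X"
  have "Cauchy (\<lambda>n. re_part (X n))" "Cauchy (\<lambda>n. im_part (X n))"
    using X norm_parts_le unfolding Cauchy_iff
    by (metis (no_types, lifting) cpx_parts(5,6) le_less_trans)+
  then obtain a b where ab: "(\<lambda>n. re_part (X n)) \<longlonglongrightarrow> a" "(\<lambda>n. im_part (X n)) \<longlonglongrightarrow> b"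
    using Cauchy_convergent unfolding convergent_def by blast
  have "(\<lambda>n. norm (re_part (X n) - a) + norm (im_part (X n) - b)) \<longlonglongrightarrow> 0 + 0"
    by (intro tendsto_add tendsto_norm_zero LIM_zero ab)
  then have lim0: "(\<lambda>n. norm (re_part (X n) - a) + norm (im_part (X n) - b)) \<longlonglongrightarrow> 0" by simp
  have "norm (X n - Cpx a b) \<le> norm (re_part (X n) - a) + norm (im_part (X n) - b)" for n
    using norm_parts_le(3)[of "X n - Cpx a b"] by simp
  then have "(\<lambda>n. X n - Cpx a b) \<longlonglongrightarrow> 0"
    by (intro Lim_null_comparison[OF _ lim0] always_eventually allI)
  then have "X \<longlonglongrightarrow> Cpx a b"
    by (rule LIM_zero_cancel)
  then show "convergent X" by (rule convergentI)
qed


section \<open>Semigroups and principal ideals\<close>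

definition bounded_clinear ::
    "('a::banach_lattice complexification \<Rightarrow> 'b::banach_lattice complexification) \<Rightarrow> bool" where
  "bounded_clinear A \<longleftrightarrow> bounded_linear A \<and> (\<forall>c f. A (c *\<^sub>C f) = c *\<^sub>C A f)"

text \<open>Families \<open>(T\<^sub>t)\<^sub>t\<^sub>\<ge>\<^sub>0\<close> are modelled by functions on all of \<^typ>\<open>real\<close> of which only the values at
  \<open>t \<ge> 0\<close> matter.\<close>

definition C0_semigroup ::
    "(real \<Rightarrow> 'a::banach_lattice complexification \<Rightarrow> 'a complexification) \<Rightarrow> bool" where
  "C0_semigroup T \<longleftrightarrow>
     (\<forall>t\<ge>0. bounded_clinear (T t)) \<and>
     (\<forall>f. T 0 f = f) \<and>
     (\<forall>s\<ge>0. \<forall>t\<ge>0. \<forall>f. T (s + t) f = T s (T t f)) \<and>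
     (\<forall>f. ((\<lambda>t. T t f) \<longlongrightarrow> f) (at_right 0))"

definition individually_eventually_positive ::
    "(real \<Rightarrow> 'a::banach_lattice complexification \<Rightarrow> 'a complexification) \<Rightarrow> bool" where
  "individually_eventually_positive T \<longleftrightarrow> (\<forall>f\<ge>0. \<exists>t\<^sub>f\<ge>0. \<forall>t\<ge>t\<^sub>f. 0 \<le> T t f)"

definition principal_ideal ::
    "'a::banach_lattice complexification \<Rightarrow> 'a complexification set" where
  "principal_ideal g = {f. \<exists>c\<ge>0. \<bar>f\<bar> \<le> c *\<^sub>R g}"

end

theory Submission
  imports Defs
begin

text \<open>The bound says that \<open>T\<^sub>t J y\<close> lies in the order interval \<open>[-w, w]\<close> with
  \<open>w = (C * norm y) *\<^sub>R T\<^sub>t g\<close>, and one \<open>C\<close> and one starting time must serve all \<open>y\<close>. For a single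
  \<open>y\<close> this is immediate: \<open>J y \<in> E\<^sub>g\<close> means that \<open>c *\<^sub>R g + J y\<close> and \<open>c *\<^sub>R g - J y\<close> are positive
  for some \<open>c\<close>, and eventual positivity applies to each of these two vectors.

  Uniformity comes from the Baire category theorem in \<open>Y\<close>. For each \<open>n\<close>, let \<open>A n\<close> consist of the
  \<open>y\<close> for which \<open>T\<^sub>t J y \<in> [- n *\<^sub>R T\<^sub>t g, n *\<^sub>R T\<^sub>t g]\<close> whenever \<open>t \<ge> n\<close>; the single index \<open>n\<close>
  controls the constant and the starting time together. By the previous paragraph the sets \<open>A n\<close>
  cover \<open>Y\<close>. Order intervals are closed and convex, so each \<open>A n\<close>, being an intersection of
  preimages of such intervals under bounded linear maps, is closed, convex and symmetric.
  Hence some \<open>A n\<close> contains a ball of positive radius \<open>r\<close> around \<open>0\<close>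
  (lemma \<open>closed_convex_symmetric_cover_imp_cball\<close>), and rescaling gives the estimate with
  \<open>C = n / r\<close> for all \<open>t \<ge> n\<close>. Taking \<open>t\<^sub>0 \<ge> n\<close> so large that \<open>T\<^sub>t g\<close> is positive from \<open>t\<^sub>0\<close> on
  gives the remaining claim; it does not follow from the estimate when \<open>C = 0\<close>.\<close>

text \<open>By Baire some \<open>A n\<close> contains a ball \<open>cball a r\<close>. Symmetry adds the reflected ball around
  \<open>- a\<close>, and every small \<open>y\<close> is the midpoint of \<open>a + y\<close> and \<open>- (a - y)\<close>.\<close>

lemma closed_convex_symmetric_cover_imp_cball:
  fixes A :: "nat \<Rightarrow> 'y::banach set"
  assumes closed: "\<And>n. closed (A n)"
    and convex: "\<And>n. convex (A n)"
    and symmetric: "\<And>n y. y \<in> A n \<Longrightarrow> - y \<in> A n"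
    and cover: "(\<Union>n. A n) = UNIV"
  shows "\<exists>n. \<exists>r>0. cball 0 r \<subseteq> A n"
proof -
  have "\<exists>n. interior (A n) \<noteq> {}"
  proof (rule ccontr)
    assume "\<not> ?thesis"
    then have "euclidean interior_of \<Union>(range A) = {}"
      using closed by (intro Baire_category_alt disjI1 completely_metrizable_space_euclidean) auto
    with cover show False by simp
  qed
  then obtain n a where "a \<in> interior (A n)" by blast
  then obtain r where r: "r > 0" "cball a r \<subseteq> A n"
    by (meson mem_interior_cball)
  have "y \<in> A n" if "y \<in> cball 0 r" for y
  proof -
    have "a + y \<in> A n" "a - y \<in> A n"
      using that by (auto intro!: subsetD[OF r(2)] simp: dist_norm)
    then have "a + y \<in> A n" "- (a - y) \<in> A n"
      by (blast intro: symmetric)+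
    then have "(1/2) *\<^sub>R (a + y) + (1/2) *\<^sub>R (- (a - y)) \<in> A n"
      by (intro convexD[OF convex]) auto
    moreover have "(1/2) *\<^sub>R (a + y) + (1/2) *\<^sub>R (- (a - y)) = y"
      by (simp add: algebra_simps flip: scaleR_add_left)
    ultimately show ?thesis by simp
  qed
  with r(1) show ?thesis by blast
qed

lemma symmetric_order_interval_iff:
  fixes z w :: "'a::ordered_ab_group_add"
  shows "z \<in> {- w..w} \<longleftrightarrow> 0 \<le> w + z \<and> 0 \<le> w - z"
  using diff_ge_0_iff_ge[of z "- w"] by (simp add: add.commute)

lemma convex_order_interval:
  fixes a b :: "'a::ordered_real_vector"
  shows "convex {a..b}"
proof (rule convexI)
  fix x y and u v :: real
  assume xy: "x \<in> {a..b}" "y \<in> {a..b}" and uv: "0 \<le> u" "0 \<le> v" "u + v = 1"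
  have "u *\<^sub>R a + v *\<^sub>R a \<le> u *\<^sub>R x + v *\<^sub>R y" "u *\<^sub>R x + v *\<^sub>R y \<le> u *\<^sub>R b + v *\<^sub>R b"
    using xy uv by (auto intro!: add_mono scaleR_left_mono)
  then show "u *\<^sub>R x + v *\<^sub>R y \<in> {a..b}"
    by (simp add: uv(3) flip: scaleR_add_left)
qed

lemma bounded_linear_re_part: "bounded_linear (re_part :: 'a::banach_lattice complexification \<Rightarrow> 'a)"
  by (rule bounded_linear_intro[where K = 1]) (simp_all add: norm_parts_le)

lemma bounded_linear_im_part: "bounded_linear (im_part :: 'a::banach_lattice complexification \<Rightarrow> 'a)"
  by (rule bounded_linear_intro[where K = 1]) (simp_all add: norm_parts_le)

lemma bounded_linear_of_re: "bounded_linear (of_re :: 'a::banach_lattice \<Rightarrow> 'a complexification)"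
  by (rule bounded_linear_intro[where K = 1]) (simp_all add: cpx_eq_iff)

lemma closed_nonneg_complexification: "closed {z :: 'a::banach_lattice complexification. 0 \<le> z}"
proof -
  have "{z :: 'a complexification. 0 \<le> z} = re_part -` {x. 0 \<le> x} \<inter> im_part -` {0}"
    by (auto simp: less_eq_complexification_def)
  moreover have "closed \<dots>"
    by (intro closed_Int closed_vimage closed_nonneg_lattice closed_singleton
        linear_continuous_on bounded_linear_re_part bounded_linear_im_part)
  ultimately show ?thesis by simp
qed

lemma closed_order_interval_complexification:
  fixes a b :: "'a::banach_lattice complexification"
  shows "closed {a..b}"
proof -
  have "{a..b} = (\<lambda>z. z - a) -` {z. 0 \<le> z} \<inter> (\<lambda>z. b - z) -` {z. 0 \<le> z}"
    by auto
  moreover have "closed \<dots>"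
    by (intro closed_Int closed_vimage closed_nonneg_complexification continuous_intros)
  ultimately show ?thesis by simp
qed

text \<open>The order on \<open>E\<close> compares only elements with the same imaginary part, so \<open>- w \<le> z \<le> w\<close> forces
  \<open>z\<close> and \<open>w\<close> to be real, where the complex modulus is the lattice absolute value.\<close>

lemma abs_complexification_le:
  fixes z w :: "'a::banach_lattice complexification"
  assumes "z \<in> {- w..w}"
  shows "\<bar>z\<bar> \<le> w"
proof -
  have im: "im_part z = im_part w" "im_part w = - im_part w"
    and re: "re_part z \<le> re_part w" "- re_part w \<le> re_part z"
    using assms by (auto simp: less_eq_complexification_def)
  have "2 *\<^sub>R im_part w = im_part w + im_part w" by (rule scaleR_2)
  also have "\<dots> = 0" using im(2) by (metis add.right_inverse)
  finally have "im_part w = 0" by simp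
  with im have "z = of_re (re_part z)" "w = of_re (re_part w)"
    by (simp_all add: cpx_eq_iff)
  moreover have "\<bar>re_part z\<bar> \<le> re_part w"
    using re by (intro abs_leI) (auto simp: minus_le_iff)
  ultimately show ?thesis
    by (metis abs_complexification_def modulus_of_re of_re_le_iff)
qed

lemma of_re_in_order_interval:
  assumes "\<bar>of_re x\<bar> \<le> w"
  shows "of_re x \<in> {- w..w}"
proof -
  have "\<bar>x\<bar> \<le> re_part w" "im_part w = 0"
    using assms by (auto simp: abs_complexification_def less_eq_complexification_def)
  moreover from this(1) have "x \<le> re_part w" "- x \<le> re_part w"
    using abs_ge_self[of x] abs_ge_minus_self[of x] by (blast intro: order.trans)+
  ultimately show ?thesis
    by (auto simp: less_eq_complexification_def minus_le_iff)
qed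

lemma eventually_nonneg_at_top:
  assumes "individually_eventually_positive T" "0 \<le> f"
  shows "\<forall>\<^sub>F t in at_top. 0 \<le> T t f"
  using assms unfolding individually_eventually_positive_def eventually_at_top_linorder by blast

text \<open>The case of a single vector. Enlarging \<open>n\<close> enlarges the interval only where \<open>T t g\<close> is
  positive, hence eventual positivity is used for \<open>g\<close> in addition to \<open>c *\<^sub>R g + f\<close> and
  \<open>c *\<^sub>R g - f\<close>.\<close>

lemma eventually_in_order_interval:
  assumes linear: "\<And>t. 0 \<le> t \<Longrightarrow> linear (T t)"
    and pos: "individually_eventually_positive T"
    and "0 \<le> g" "f \<in> {- (c *\<^sub>R g)..c *\<^sub>R g}"
  shows "\<exists>n::nat. \<forall>t\<ge>real n. T t f \<in> {- (real n *\<^sub>R T t g)..real n *\<^sub>R T t g}"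
proof -
  have "0 \<le> c *\<^sub>R g + f" "0 \<le> c *\<^sub>R g - f"
    using assms(4) by (simp_all only: symmetric_order_interval_iff)
  then have "\<forall>\<^sub>F t in at_top. 0 \<le> T t g \<and> 0 \<le> T t (c *\<^sub>R g + f) \<and> 0 \<le> T t (c *\<^sub>R g - f)"
    using \<open>0 \<le> g\<close> pos by (intro eventually_conj eventually_nonneg_at_top)
  then obtain s where s: "\<And>t. t \<ge> s \<Longrightarrow>
      0 \<le> T t g \<and> 0 \<le> T t (c *\<^sub>R g + f) \<and> 0 \<le> T t (c *\<^sub>R g - f)"
    by (auto simp: eventually_at_top_linorder)
  obtain n :: nat where n: "max c s \<le> real n"
    using real_arch_simple by blast
  have "T t f \<in> {- (real n *\<^sub>R T t g)..real n *\<^sub>R T t g}" if t: "real n \<le> t" for t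
  proof -
    interpret linear "T t" using t by (intro linear) simp
    have "c *\<^sub>R T t g \<le> real n *\<^sub>R T t g"
      using n t s[of t] by (intro scaleR_right_mono) auto
    moreover have "0 \<le> c *\<^sub>R T t g + T t f" "0 \<le> c *\<^sub>R T t g - T t f"
      using n t s[of t] by (simp_all add: add diff scaleR)
    ultimately have "0 \<le> real n *\<^sub>R T t g + T t f" "0 \<le> real n *\<^sub>R T t g - T t f"
      by (meson add_right_mono diff_right_mono order.trans)+
    then show ?thesis by (simp only: symmetric_order_interval_iff)
  qed
  then show ?thesis by blast
qed

theorem corollary2p2:
  fixes T :: "real \<Rightarrow> 'a::banach_lattice complexification \<Rightarrow> 'a complexification"
    and g :: "'a complexification"
    and J :: "'y::banach \<Rightarrow> 'a"
  assumes "C0_semigroup T"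
    and "individually_eventually_positive T"
    and "0 \<le> g"
    and "bounded_linear J"
    and "\<And>y. of_re (J y) \<in> principal_ideal g"
  shows "\<exists>t\<^sub>0\<ge>0. \<exists>C\<ge>0. \<forall>t\<ge>t\<^sub>0.
    (\<forall>y. \<bar>T t (of_re (J y))\<bar> \<le> (C * norm y) *\<^sub>R T t g) \<and> 0 \<le> T t g"
proof -
  have T: "bounded_linear (T t)" if "0 \<le> t" for t
    using assms(1) that by (auto simp: C0_semigroup_def bounded_clinear_def)
  define L where "L = (\<lambda>t y. T t (of_re (J y)))"
  have L: "bounded_linear (L t)" if "0 \<le> t" for t
    unfolding L_def
    by (intro bounded_linear_compose[OF T[OF that]]
        bounded_linear_compose[OF bounded_linear_of_re] assms(4))
  define I where "I = (\<lambda>n t. {- (real n *\<^sub>R T t g)..real n *\<^sub>R T t g})"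
  define A where "A = (\<lambda>n::nat. \<Inter>t\<in>{real n..}. L t -` I n t)"
  have "\<exists>n. \<exists>r>0. cball 0 r \<subseteq> A n"
  proof (rule closed_convex_symmetric_cover_imp_cball)
    fix n
    show "closed (A n)"
      unfolding A_def I_def
      by (intro closed_INT ballI closed_vimage closed_order_interval_complexification
          linear_continuous_on L) simp
    show "convex (A n)"
      unfolding A_def I_def
      by (intro convex_INT convex_linear_vimage convex_order_interval
          bounded_linear.linear L) simp
    fix y assume y: "y \<in> A n"
    have "L t (- y) \<in> I n t" if "t \<ge> real n" for t
    proof -
      have "L t (- y) = - L t y"
        using that by (intro linear_neg bounded_linear.linear L) simp
      then show ?thesis using y that by (auto simp: A_def I_def minus_le_iff)
    qed
    then show "- y \<in> A n" by (simp add: A_def)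
  next
    have "\<exists>n. y \<in> A n" for y
    proof -
      obtain c where "\<bar>of_re (J y)\<bar> \<le> c *\<^sub>R g"
        using assms(5)[of y] by (auto simp: principal_ideal_def)
      then have "of_re (J y) \<in> {- (c *\<^sub>R g)..c *\<^sub>R g}"
        by (rule of_re_in_order_interval)
      then have "\<exists>n::nat. \<forall>t\<ge>real n. L t y \<in> I n t"
        unfolding L_def I_def using T assms(2,3)
        by (intro eventually_in_order_interval bounded_linear.linear)
      then show ?thesis by (auto simp: A_def)
    qed
    then show "(\<Union>n. A n) = UNIV" by blast
  qed
  then obtain n r where r: "r > 0" and A: "cball 0 r \<subseteq> A n"
    by blast
  obtain s where s: "\<And>t. t \<ge> s \<Longrightarrow> 0 \<le> T t g"
    using eventually_nonneg_at_top[OF assms(2,3)] by (auto simp: eventually_at_top_linorder)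
  have bound: "\<bar>T t (of_re (J y))\<bar> \<le> (real n / r * norm y) *\<^sub>R T t g"
    if t: "real n \<le> t" for t y
  proof -
    interpret L: bounded_linear "L t" using t by (intro L) simp
    have "L t y \<in> {- ((real n / r * norm y) *\<^sub>R T t g)..(real n / r * norm y) *\<^sub>R T t g}"
    proof (cases "y = 0")
      case True
      then show ?thesis by (simp add: L.zero)
    next
      case False
      define k where "k = norm y / r"
      have k: "k > 0" using False r by (simp add: k_def)
      have "(1 / k) *\<^sub>R y \<in> A n"
        using False r by (intro subsetD[OF A]) (simp add: k_def)
      then have "L t ((1 / k) *\<^sub>R y) \<in> I n t"
        using t by (simp add: A_def)
      then have "k *\<^sub>R (- (real n *\<^sub>R T t g)) \<le> k *\<^sub>R L t ((1 / k) *\<^sub>R y)"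
        "k *\<^sub>R L t ((1 / k) *\<^sub>R y) \<le> k *\<^sub>R (real n *\<^sub>R T t g)"
        using k by (auto simp only: I_def atLeastAtMost_iff intro!: scaleR_left_mono)
      then show ?thesis
        using k by (simp add: L.scaleR) (simp add: k_def mult.commute)
    qed
    then show ?thesis
      unfolding L_def by (rule abs_complexification_le)
  qed
  show ?thesis
  proof (intro exI conjI allI impI)
    show "0 \<le> max (real n) s" "0 \<le> real n / r" using r by (auto simp: le_max_iff_disj)
  qed (use bound s in auto)
qed

end
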